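(* The intersection graph of $n$ axis-aligned rectangles in $\mathbb{R}^2$ admits a $3$-hop spanner of size $O(n\log n)$.
   Context: Rectangles are closed axis-aligned rectangles (including their interiors). The intersection graph has the rectangles as vertices, with an edge iff the two rectangles intersect. For a graph $G$ and integer $t\ge1$, a $t$-hop spanner is a subgraph $\widehat{G}$ of $G$ on the same vertex set such that for every edge $uv\in E(G)$ there is a $u$–$v$ path in $\widehat{G}$ with at most $t$ edges; its size is its number of edges. *)

theory Defs
  imports Complex_Main
begin

definition axis_rect :: "(real \<times> real) set \<Rightarrow> bool" where
  "axis_rect R \<longleftrightarrow> (\<exists>a b c d. a \<le> b \<and> c \<le> d \<and> R = {a..b} \<times> {c..d})"

definition isect_edges :: "'a set set \<Rightarrow> 'a set set set" where
  "isect_edges S = {{u, v} | u v. u \<in> S \<and> v \<in> S \<and> u \<noteq> v \<and> u \<inter> v \<noteq> {}}"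

definition hop_path :: "'v set set \<Rightarrow> nat \<Rightarrow> 'v \<Rightarrow> 'v \<Rightarrow> bool" where
  "hop_path H t u v \<longleftrightarrow> (\<exists>ps. ps \<noteq> [] \<and> hd ps = u \<and> last ps = v \<and> length ps \<le> t + 1 \<and>
      (\<forall>i < length ps - 1. {ps ! i, ps ! (i + 1)} \<in> H))"

definition is_hop_spanner :: "'v set set \<Rightarrow> 'v set set \<Rightarrow> nat \<Rightarrow> bool" where
  "is_hop_spanner E H t \<longleftrightarrow> H \<subseteq> E \<and> (\<forall>u v. {u, v} \<in> E \<longrightarrow> hop_path H t u v)"

end

(* Two rectangles meet iff their x-intervals and their y-intervals meet, and two intervals meet iff
   one contains the left end of the other.  A segment tree over the left ends of the x-intervals
   reduces the problem to O(n log n) total size of bipartite instances in which all x-intervals of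
   one side meet all x-intervals of the other, so that only the y-coordinates matter.  Such an
   instance is a union of two point-interval incidence graphs on the line.  Each of these has a
   3-hop spanner of linear size: sweep greedily from left to right, always choosing the interval
   through the first uncovered point that reaches furthest to the right; join every point to the
   chosen interval covering it, and every interval to the first and to the last point in it. *)
theory Submission
  imports Defs
begin

section \<open>Point-interval incidences and overlapping intervals on a line\<close>

text \<open>\<open>d x\<close> is the point that opens the greedy round covering \<open>x\<close>.
  The least point \<open>q\<close> opens the first round, which takes every point up to
  \<open>reach q\<close>; induction deals with the points beyond. The last clause records that a
  round is a full block: every point between its leader and the leader's reach belongs to
  it.\<close>

lemma greedy_leaders:
  fixes X :: "'a::linorder set"
  assumes "finite X" "\<And>x. x \<in> X \<Longrightarrow> x \<le> reach x"
  shows "\<exists>d. \<forall>x\<in>X. d x \<in> X \<and> d x \<le> x \<and> x \<le> reach (d x) \<and>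
           (\<forall>y\<in>X. d x \<le> y \<and> y \<le> reach (d x) \<longrightarrow> d y = d x)"
  using assms
proof (induction X rule: finite_psubset_induct)
  case (psubset X)
  show ?case
  proof (cases "X = {}")
    case False
    define q where "q = Min X"
    have q: "q \<in> X" "\<And>x. x \<in> X \<Longrightarrow> q \<le> x"
      using False psubset.hyps by (auto simp: q_def)
    define Y where "Y = {x \<in> X. reach q < x}"
    have "Y \<subset> X"
    proof
      show "Y \<subseteq> X" unfolding Y_def by blast
      show "Y \<noteq> X" using q(1) psubset.prems[OF q(1)] not_less unfolding Y_def by blast
    qed
    then obtain d where d: "\<forall>x\<in>Y. d x \<in> Y \<and> d x \<le> x \<and> x \<le> reach (d x) \<and>
           (\<forall>y\<in>Y. d x \<le> y \<and> y \<le> reach (d x) \<longrightarrow> d y = d x)"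
    proof (rule exE[OF psubset.IH[of Y]])
      show "x \<le> reach x" if "x \<in> Y" for x
        using psubset.prems that by (simp add: Y_def)
    qed
    show ?thesis
    proof (intro exI[of _ "\<lambda>x. if x \<le> reach q then q else d x"] ballI)
      fix x assume x: "x \<in> X"
      let ?d = "\<lambda>x. if x \<le> reach q then q else d x"
      show "?d x \<in> X \<and> ?d x \<le> x \<and> x \<le> reach (?d x) \<and>
           (\<forall>y\<in>X. ?d x \<le> y \<and> y \<le> reach (?d x) \<longrightarrow> ?d y = ?d x)"
      proof (cases "x \<le> reach q")
        case True
        then show ?thesis using q x by simp
      next
        case False
        then have "x \<in> Y" using x by (auto simp: Y_def)
        then have dx: "d x \<in> Y" "d x \<le> x" "x \<le> reach (d x)"
          and same: "\<And>y. y \<in> Y \<Longrightarrow> d x \<le> y \<Longrightarrow> y \<le> reach (d x) \<Longrightarrow> d y = d x"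
          using d by blast+
        \<comment> \<open>\<open>d x\<close> opens a later round and so lies beyond
          \<open>reach q\<close>; hence no \<open>y\<close> above it belongs to the first
          round.\<close>
        have "?d y = d x" if "y \<in> X" "d x \<le> y" "y \<le> reach (d x)" for y
        proof -
          have "reach q < y" using that(2) dx(1) unfolding Y_def by auto
          then have "y \<in> Y" "\<not> y \<le> reach q" using that(1) by (simp_all add: Y_def)
          then show ?thesis using same[of y] that(2,3) by simp
        qed
        moreover have "d x \<in> X" using dx(1) by (simp add: Y_def)
        ultimately show ?thesis
          using False dx(2,3) by simp
      qed
    qed
  qed auto
qed

lemma finite_max_witness:
  fixes h :: "'a \<Rightarrow> 'b::linorder"
  assumes "finite X" "X \<noteq> {}"
  shows "\<exists>w\<in>X. \<forall>v\<in>X. h v \<le> h w"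
proof -
  have "Max (h ` X) \<in> h ` X" using assms by (intro Max_in) auto
  moreover have "h v \<le> Max (h ` X)" if "v \<in> X" for v using assms that by simp
  ultimately show ?thesis by (metis imageE)
qed

text \<open>A walk u - v' - u' - v in a bipartite graph. Repetitions are allowed, so a pair in
  \<open>P\<close> is itself linked. Ordered pairs keep the two sides apart even if an element
  occurs on both.\<close>

definition linked :: "('a \<times> 'b) set \<Rightarrow> 'a \<Rightarrow> 'b \<Rightarrow> bool" where
  "linked P u v \<longleftrightarrow> (\<exists>u' v'. (u, v') \<in> P \<and> (u', v') \<in> P \<and> (u', v) \<in> P)"

lemma linked_converse: "linked (P\<inverse>) u v \<longleftrightarrow> linked P v u"
  unfolding linked_def by blast

lemma linked_mono: "linked P u v \<Longrightarrow> P \<subseteq> Q \<Longrightarrow> linked Q u v"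
  unfolding linked_def by blast

text \<open>Let \<open>u\<close> lie in \<open>v\<close>, in the round opened at
  \<open>d (f u)\<close>. If the leftmost point of \<open>v\<close> is not before
  \<open>d (f u)\<close>, it lies in the same block as \<open>u\<close>. Otherwise \<open>v\<close>
  contains \<open>d (f u)\<close>, so the interval chosen there reaches at least as far as
  \<open>v\<close>, and the rightmost point of \<open>v\<close> lies in that block. Either way an
  extreme point u' of \<open>v\<close> shares its chosen interval with \<open>u\<close>, which gives
  u - c u - u' - v. The cost is one pair per point and two per interval.\<close>

lemma stabbing_spanner:
  fixes f :: "'a \<Rightarrow> 'c::linorder" and g h :: "'b \<Rightarrow> 'c"
  assumes A: "finite A" and B: "finite B"
  shows "\<exists>P. P \<subseteq> {(u, v). u \<in> A \<and> v \<in> B \<and> g v \<le> f u \<and> f u \<le> h v} \<and>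
           card P \<le> card A + 2 * card B \<and>
           (\<forall>u\<in>A. \<forall>v\<in>B. g v \<le> f u \<and> f u \<le> h v \<longrightarrow>
              linked P u v)"
proof -
  define inc where "inc = (\<lambda>x v. v \<in> B \<and> g v \<le> x \<and> x \<le> h v)"
  \<comment> \<open>Points in no interval and intervals without points have no incidences; leaving
    them out makes all the choices below possible.\<close>
  define A' where "A' = {u \<in> A. \<exists>v. inc (f u) v}"
  define B' where "B' = {v \<in> B. \<exists>u\<in>A. inc (f u) v}"
  have fin: "finite A'" "finite B'" using A B by (auto simp: A'_def B'_def)
  have "\<exists>w. inc x w \<and> (\<forall>v. inc x v \<longrightarrow> h v \<le> h w)" if "x \<in> f ` A'" for x
  proof -
    have "finite {v. inc x v}" "{v. inc x v} \<noteq> {}"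
      using B that by (auto simp: inc_def A'_def)
    from finite_max_witness[OF this, of h] show ?thesis by auto
  qed
  then have "\<forall>x\<in>f ` A'. \<exists>w. inc x w \<and> (\<forall>v. inc x v \<longrightarrow> h v \<le> h w)" by blast
  from bchoice[OF this] obtain best where best: "\<And>x. x \<in> f ` A' \<Longrightarrow> inc x (best x)"
    "\<And>x v. x \<in> f ` A' \<Longrightarrow> inc x v \<Longrightarrow> h v \<le> h (best x)"
    by blast
  \<comment> \<open>Rounds are formed on coordinates, so points with equal coordinates share a
    round; the reach of \<open>x\<close> is the right end of the best interval through
    \<open>x\<close>.\<close>
  obtain d where d: "\<And>x. x \<in> f ` A' \<Longrightarrow> d x \<in> f ` A'"
    "\<And>x. x \<in> f ` A' \<Longrightarrow> d x \<le> x"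
    "\<And>x. x \<in> f ` A' \<Longrightarrow> x \<le> h (best (d x))"
    "\<And>x y. x \<in> f ` A' \<Longrightarrow> y \<in> f ` A' \<Longrightarrow> d x \<le> y \<Longrightarrow> y \<le> h (best (d x)) \<Longrightarrow> d y = d x"
  proof -
    have "finite (f ` A')" "\<And>x. x \<in> f ` A' \<Longrightarrow> x \<le> h (best x)"
      using fin best(1) by (simp_all add: inc_def)
    from greedy_leaders[of "f ` A'" "\<lambda>x. h (best x)", OF this] that show ?thesis by blast
  qed
  have "\<exists>u\<in>A. inc (f u) v \<and> (\<forall>w\<in>A. inc (f w) v \<longrightarrow> f u \<le> f w)" if "v \<in> B'" for v
  proof -
    have "finite {u\<in>A. inc (f u) v}" "{u\<in>A. inc (f u) v} \<noteq> {}"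
      using A that by (auto simp: B'_def)
    from ex_is_arg_min_if_finite[OF this, of f] show ?thesis
      by (auto simp: is_arg_min_def not_less)
  qed
  then have "\<forall>v\<in>B'. \<exists>u. u \<in> A \<and> inc (f u) v \<and> (\<forall>w\<in>A. inc (f w) v \<longrightarrow> f u \<le> f w)" by blast
  from bchoice[OF this] obtain l where l: "\<And>v. v \<in> B' \<Longrightarrow> l v \<in> A" "\<And>v. v \<in> B' \<Longrightarrow> inc (f (l v)) v"
    "\<And>v w. v \<in> B' \<Longrightarrow> w \<in> A \<Longrightarrow> inc (f w) v \<Longrightarrow> f (l v) \<le> f w"
    by blast
  have "\<exists>u\<in>A. inc (f u) v \<and> (\<forall>w\<in>A. inc (f w) v \<longrightarrow> f w \<le> f u)" if "v \<in> B'" for v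
  proof -
    have "finite {u\<in>A. inc (f u) v}" "{u\<in>A. inc (f u) v} \<noteq> {}"
      using A that by (auto simp: B'_def)
    from finite_max_witness[OF this, of f] show ?thesis by auto
  qed
  then have "\<forall>v\<in>B'. \<exists>u. u \<in> A \<and> inc (f u) v \<and> (\<forall>w\<in>A. inc (f w) v \<longrightarrow> f w \<le> f u)" by blast
  from bchoice[OF this] obtain r where r: "\<And>v. v \<in> B' \<Longrightarrow> r v \<in> A" "\<And>v. v \<in> B' \<Longrightarrow> inc (f (r v)) v"
    "\<And>v w. v \<in> B' \<Longrightarrow> w \<in> A \<Longrightarrow> inc (f w) v \<Longrightarrow> f w \<le> f (r v)"
    by blast
  define c where "c = (\<lambda>u. best (d (f u)))"
  \<comment> \<open>The chosen interval contains the leader \<open>d (f u)\<close>, which is at most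
    \<open>f u\<close>, and extends to the right at least up to \<open>f u\<close>.\<close>
  have c: "inc (f u) (c u)" if "u \<in> A'" for u
  proof -
    have u: "f u \<in> f ` A'" using that by blast
    show ?thesis
      using best(1)[OF d(1)[OF u]] d(2,3)[OF u] by (auto simp: c_def inc_def)
  qed
  define P where "P = (\<lambda>u. (u, c u)) ` A' \<union> (\<lambda>v. (l v, v)) ` B' \<union> (\<lambda>v. (r v, v)) ` B'"
  have "card P \<le> card A' + card B' + card B'"
    unfolding P_def
    by (intro order_trans[OF card_Un_le] add_mono card_image_le fin)
  also have "\<dots> \<le> card A + card B + card B"
    by (intro add_mono card_mono A B) (auto simp: A'_def B'_def)
  finally have "card P \<le> card A + 2 * card B" by simp
  moreover have "P \<subseteq> {(u, v). u \<in> A \<and> v \<in> B \<and> g v \<le> f u \<and> f u \<le> h v}"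
  proof -
    have "u \<in> A \<and> inc (f u) v" if "(u, v) \<in> P" for u v
      using that c l r by (auto simp: P_def A'_def)
    then show ?thesis by (auto simp: inc_def)
  qed
  moreover have "linked P u v"
    if "u \<in> A" "v \<in> B" "g v \<le> f u" "f u \<le> h v" for u v
  proof -
    have uv: "inc (f u) v" "u \<in> A'" "v \<in> B'"
      using that by (auto simp: inc_def A'_def B'_def)
    have fu: "f u \<in> f ` A'" using uv by blast
    have lA: "l v \<in> A'" "r v \<in> A'" using l(1,2)[OF uv(3)] r(1,2)[OF uv(3)] unfolding A'_def by blast+
    have lr: "f (l v) \<le> f u" "f u \<le> f (r v)"
      using l(3)[OF uv(3) that(1) uv(1)] r(3)[OF uv(3) that(1) uv(1)] .
    have "c (l v) = c u \<or> c (r v) = c u"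
    proof (cases "d (f u) \<le> f (l v)")
      case True
      then have "d (f (l v)) = d (f u)"
        using d(4)[OF fu] lA lr d(3)[OF fu] by (meson image_eqI order_trans)
      then show ?thesis by (simp add: c_def)
    next
      case False
      \<comment> \<open>Then \<open>v\<close> contains the point \<open>d (f u)\<close>, whose interval reaches at least as far as \<open>v\<close>.\<close>
      then have "inc (d (f u)) v"
        using l(2)[OF uv(3)] d(2)[OF fu] uv(1) by (auto simp: inc_def)
      then have "h v \<le> h (best (d (f u)))"
        using best(2) d(1)[OF fu] by blast
      then have "f (r v) \<le> h (best (d (f u)))"
        using r(2)[OF uv(3)] by (auto simp: inc_def)
      moreover have "d (f u) \<le> f (r v)" using d(2)[OF fu] lr by simp
      ultimately have "d (f (r v)) = d (f u)"
        using d(4)[OF fu] lA by blast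
      then show ?thesis by (simp add: c_def)
    qed
    then obtain u' where "u' \<in> A'" "c u' = c u" "(u', v) \<in> P"
      using lA uv(3) unfolding P_def by blast
    moreover have "(u, c u) \<in> P" "(u', c u') \<in> P"
      using uv(2) \<open>u' \<in> A'\<close> by (auto simp: P_def)
    ultimately show ?thesis by (auto simp: linked_def)
  qed
  ultimately show ?thesis by (intro exI[of _ P]) blast
qed

text \<open>One incidence instance takes the left ends of \<open>A\<close> as points and
  \<open>B\<close> as intervals, the other exchanges the roles and is reversed afterwards. The sizes
  a + 2b and b + 2a add up to 3(a + b).\<close>

lemma overlap_spanner:
  fixes lo hi :: "'a \<Rightarrow> 'c::linorder"
  assumes A: "finite A" and B: "finite B"
    and le: "\<And>u. u \<in> A \<union> B \<Longrightarrow> lo u \<le> hi u"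
  shows "\<exists>P. P \<subseteq> {(u, v). u \<in> A \<and> v \<in> B \<and> lo v \<le> hi u \<and> lo u \<le> hi v} \<and>
           card P \<le> 3 * (card A + card B) \<and>
           (\<forall>u\<in>A. \<forall>v\<in>B. lo v \<le> hi u \<and> lo u \<le> hi v \<longrightarrow>
              linked P u v)"
proof -
  obtain P where P: "P \<subseteq> {(u, v). u \<in> A \<and> v \<in> B \<and> lo v \<le> lo u \<and> lo u \<le> hi v}"
    "card P \<le> card A + 2 * card B"
    "\<And>u v. u \<in> A \<Longrightarrow> v \<in> B \<Longrightarrow> lo v \<le> lo u \<Longrightarrow> lo u \<le> hi v \<Longrightarrow>
       linked P u v"
    using stabbing_spanner[OF A B, of lo lo hi] by blast
  obtain Q where Q: "Q \<subseteq> {(v, u). v \<in> B \<and> u \<in> A \<and> lo u \<le> lo v \<and> lo v \<le> hi u}"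
    "card Q \<le> card B + 2 * card A"
    "\<And>v u. v \<in> B \<Longrightarrow> u \<in> A \<Longrightarrow> lo u \<le> lo v \<Longrightarrow> lo v \<le> hi u \<Longrightarrow>
       linked Q v u"
    using stabbing_spanner[OF B A, of lo lo hi] by blast
  have le': "\<And>u. u \<in> A \<Longrightarrow> lo u \<le> hi u" "\<And>u. u \<in> B \<Longrightarrow> lo u \<le> hi u" using le by auto
  show ?thesis
  proof (intro exI[of _ "P \<union> Q\<inverse>"] conjI ballI impI)
    show "P \<union> Q\<inverse> \<subseteq> {(u, v). u \<in> A \<and> v \<in> B \<and> lo v \<le> hi u \<and> lo u \<le> hi v}"
    proof (intro subsetI, clarify)
      fix u v assume "(u, v) \<in> P \<union> Q\<inverse>"
      then consider "u \<in> A" "v \<in> B" "lo v \<le> lo u" "lo u \<le> hi v"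
        | "v \<in> B" "u \<in> A" "lo u \<le> lo v" "lo v \<le> hi u"
        using P(1) Q(1) by auto
      then show "u \<in> A \<and> v \<in> B \<and> lo v \<le> hi u \<and> lo u \<le> hi v"
        using le'(1)[of u] le'(2)[of v] by cases auto
    qed
    show "card (P \<union> Q\<inverse>) \<le> 3 * (card A + card B)"
      using card_Un_le[of P "Q\<inverse>"] P(2) Q(2) by simp
    fix u v assume "u \<in> A" "v \<in> B" "lo v \<le> hi u \<and> lo u \<le> hi v"
    then have "linked P u v \<or> linked (Q\<inverse>) u v"
      using P(3)[of u v] Q(3)[of v u] by (cases "lo v \<le> lo u") (auto simp: linked_converse)
    then show "linked (P \<union> Q\<inverse>) u v"
      by (elim disjE linked_mono) simp_all
  qed
qed

section \<open>Canonical nodes of the segment tree\<close>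

text \<open>The \<open>j\<close>-th node on level \<open>i\<close> of the segment tree over the naturals is the block
  \<open>{j * 2 ^ i..<(j + 1) * 2 ^ i}\<close>; it is canonical for \<open>{l..<r}\<close> if it is contained in
  \<open>{l..<r}\<close> but its parent is not.\<close>
definition canonical :: "nat \<Rightarrow> nat \<Rightarrow> nat \<Rightarrow> nat \<Rightarrow> bool" where
  "canonical l r i j \<longleftrightarrow> l \<le> j * 2 ^ i \<and> (j + 1) * 2 ^ i \<le> r \<and>
     \<not> (l \<le> (j div 2) * 2 ^ Suc i \<and> (j div 2 + 1) * 2 ^ Suc i \<le> r)"

text \<open>The blocks containing \<open>p\<close> increase with the level, starting from the
  singleton at level 0, which lies in the range. The last one that still fits is canonical, since
  its parent is the block of \<open>p\<close> one level higher.\<close>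

lemma canonical_cover:
  assumes "l \<le> p" "p < r" "r < 2 ^ k"
  shows "\<exists>i<k. canonical l r i (p div 2 ^ i)"
proof -
  define ok where "ok = (\<lambda>i. l \<le> (p div 2 ^ i) * 2 ^ i \<and> (p div 2 ^ i + 1) * 2 ^ i \<le> r)"
  \<comment> \<open>A block on level \<open>i\<close> has length \<open>2 ^ i\<close> and, if it
    fits, ends at or before \<open>r\<close>, which is below \<open>2 ^ k\<close>.\<close>
  have small: "i < k" if "ok i" for i
  proof -
    have "(2::nat) ^ i \<le> (p div 2 ^ i + 1) * 2 ^ i" by simp
    also have "\<dots> < 2 ^ k" using that assms(3) unfolding ok_def by linarith
    finally show ?thesis by simp
  qed
  have "ok 0" using assms by (simp add: ok_def)
  define i where "i = Max {i. ok i}"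
  have fin: "finite {i. ok i}"
    by (rule finite_subset[of _ "{..<k}"]) (use small in auto)
  have "ok i" using Max_in[OF fin] \<open>ok 0\<close> by (auto simp: i_def)
  moreover have "\<not> ok (Suc i)" using Max_ge[OF fin, of "Suc i"] by (auto simp: i_def)
  moreover have "p div 2 ^ Suc i = p div 2 ^ i div 2"
    by (simp only: power_Suc2 div_mult2_eq)
  ultimately have "canonical l r i (p div 2 ^ i)"
    by (simp only: canonical_def ok_def) simp
  with small[OF \<open>ok i\<close>] show ?thesis by blast
qed

lemma canonical_contains:
  assumes "canonical l r i (p div 2 ^ i)"
  shows "l \<le> p" "p < r"
proof -
  have "(p div 2 ^ i) * 2 ^ i \<le> p" by simp
  then show "l \<le> p" using assms unfolding canonical_def by linarith
  have "p < (p div 2 ^ i + 1) * 2 ^ i"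
    using dividend_less_div_times[of "2 ^ i" p] by (simp add: algebra_simps)
  then show "p < r" using assms unfolding canonical_def by linarith
qed

lemma canonical_finite: "finite {j. canonical l r i j}"
proof (rule finite_subset)
  show "{j. canonical l r i j} \<subseteq> {..r}"
  proof
    fix j assume "j \<in> {j. canonical l r i j}"
    then have "(j + 1) * 2 ^ i \<le> r" unfolding canonical_def by blast
    moreover have "(j + 1) * 1 \<le> (j + 1) * 2 ^ i" by (intro mult_le_mono2) simp
    ultimately have "(j + 1) * 1 \<le> r" by (rule order_trans[rotated])
    then show "j \<in> {..r}" by simp
  qed
qed simp

text \<open>Of three canonical nodes on one level, the middle one has a parent consisting of it and
  a neighbour. This parent lies between the left end of the first node and the right end of the
  third, hence inside the range, which is a contradiction. So only the least and the greatest node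
  remain.\<close>

lemma canonical_card: "card {j. canonical l r i j} \<le> 2"
proof (cases "{j. canonical l r i j} = {}")
  case False
  let ?J = "{j. canonical l r i j}"
  have no3: False if "canonical l r i a" "canonical l r i b" "canonical l r i c" "a < b" "b < c" for a b c
  proof -
    have "a \<le> b div 2 * 2" "(b div 2 + 1) * 2 \<le> c + 1" using that(4,5) by presburger+
    then have "a * 2 ^ i \<le> b div 2 * 2 * 2 ^ i" "(b div 2 + 1) * 2 * 2 ^ i \<le> (c + 1) * 2 ^ i"
      using mult_le_mono1 by blast+
    then have "l \<le> b div 2 * 2 ^ Suc i" "(b div 2 + 1) * 2 ^ Suc i \<le> r"
      using that(1,3) unfolding canonical_def by (simp_all only: power_Suc mult.assoc) linarith+
    then show False using that(2) unfolding canonical_def by blast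
  qed
  have "?J \<subseteq> {Min ?J, Max ?J}"
  proof
    fix b assume b: "b \<in> ?J"
    have "Min ?J \<in> ?J" "Max ?J \<in> ?J" "Min ?J \<le> b" "b \<le> Max ?J"
      using Min_in[OF canonical_finite False] Max_in[OF canonical_finite False]
        Min_le[OF canonical_finite b] Max_ge[OF canonical_finite b] .
    then show "b \<in> {Min ?J, Max ?J}"
      using no3[of "Min ?J" b "Max ?J"] b by force
  qed
  then have "card ?J \<le> card {Min ?J, Max ?J}" by (rule card_mono[rotated]) simp
  also have "\<dots> \<le> 2" by (simp add: card_insert_if)
  finally show ?thesis .
qed simp

section \<open>Reduction of boxes to one dimension\<close>

lemma sum_card_swap:
  assumes "finite J" "finite S"
  shows "(\<Sum>j\<in>J. card {v\<in>S. R v j}) = (\<Sum>v\<in>S. card {j\<in>J. R v j})"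
proof -
  have "(\<Sum>j\<in>J. card {v\<in>S. R v j}) = (\<Sum>j\<in>J. \<Sum>v\<in>S. if R v j then 1 else 0)"
    using assms by (simp add: sum.If_cases Int_def)
  also have "\<dots> = (\<Sum>v\<in>S. \<Sum>j\<in>J. if R v j then 1 else 0)" by (rule sum.swap)
  also have "\<dots> = (\<Sum>v\<in>S. card {j\<in>J. R v j})"
    using assms by (simp add: sum.If_cases Int_def)
  finally show ?thesis .
qed

text \<open>Only pairs in which the left end of \<open>u\<close> lies in the x-interval of
  \<open>v\<close> are treated; the other overlapping pairs arise by exchanging \<open>u\<close> and
  \<open>v\<close>. On each level an element is a point of one node and an interval of at most two,
  so the level costs at most 3(n + 2n) = 9n, and there are \<open>k\<close> levels.\<close>

lemma box_spanner:
  fixes xl xr :: "'a \<Rightarrow> 'b::linorder" and yl yr :: "'a \<Rightarrow> 'c::linorder"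
  assumes S: "finite S" and k: "card S < 2 ^ k"
    and le: "\<And>u. u \<in> S \<Longrightarrow> yl u \<le> yr u"
  shows "\<exists>P. P \<subseteq> {(u, v). u \<in> S \<and> v \<in> S \<and> xl v \<le> xl u \<and> xl u \<le> xr v \<and> yl v \<le> yr u \<and> yl u \<le> yr v} \<and>
           card P \<le> 9 * card S * k \<and>
           (\<forall>u\<in>S. \<forall>v\<in>S. xl v \<le> xl u \<and> xl u \<le> xr v \<and> yl v \<le> yr u \<and> yl u \<le> yr v \<longrightarrow>
              linked P u v)"
proof -
  define n where "n = card S"
  \<comment> \<open>Passing to ranks turns the x-condition into \<open>p v \<le> p u\<close> and
    \<open>p u < r v\<close>. The strict count in \<open>p\<close> and the weak one in
    \<open>r\<close> make this exact even when left ends coincide.\<close>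
  define p where "p = (\<lambda>u. card {w\<in>S. xl w < xl u})"
  define r where "r = (\<lambda>v. card {w\<in>S. xl w \<le> xr v})"
  have p_le: "p v \<le> p u \<longleftrightarrow> xl v \<le> xl u" if "u \<in> S" "v \<in> S" for u v
  proof
    assume "xl v \<le> xl u"
    then show "p v \<le> p u" unfolding p_def by (intro card_mono) (use S in auto)
  next
    assume *: "p v \<le> p u"
    show "xl v \<le> xl u"
    proof (rule ccontr)
      assume "\<not> xl v \<le> xl u"
      then have less: "xl u < xl v" by simp
      have "{w\<in>S. xl w < xl u} \<subseteq> {w\<in>S. xl w < xl v}" using less by (auto intro: less_trans)
      moreover have "u \<in> {w\<in>S. xl w < xl v}" "u \<notin> {w\<in>S. xl w < xl u}" using that less by simp_all
      ultimately have "{w\<in>S. xl w < xl u} \<subset> {w\<in>S. xl w < xl v}" by blast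
      then have "p u < p v" unfolding p_def by (intro psubset_card_mono) (use S in auto)
      then show False using * by simp
    qed
  qed
  have p_less: "p u < r v \<longleftrightarrow> xl u \<le> xr v" if "u \<in> S" "v \<in> S" for u v
  proof
    assume "xl u \<le> xr v"
    then have "{w\<in>S. xl w < xl u} \<subseteq> {w\<in>S. xl w \<le> xr v}"
      "u \<in> {w\<in>S. xl w \<le> xr v}" "u \<notin> {w\<in>S. xl w < xl u}" using that by auto
    then have "{w\<in>S. xl w < xl u} \<subset> {w\<in>S. xl w \<le> xr v}" by blast
    then show "p u < r v" unfolding p_def r_def by (intro psubset_card_mono) (use S in auto)
  next
    assume *: "p u < r v"
    show "xl u \<le> xr v"
    proof (rule ccontr)
      assume "\<not> xl u \<le> xr v"
      then have "r v \<le> p u" unfolding p_def r_def by (intro card_mono) (use S in auto)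
      then show False using * by simp
    qed
  qed
  have r_le: "r v \<le> n" for v
    unfolding r_def n_def by (intro card_mono) (use S in auto)
  have p_bound: "p u \<le> n" for u
    unfolding p_def n_def by (intro card_mono) (use S in auto)
  \<comment> \<open>If \<open>u\<close> is in \<open>A i j\<close> and \<open>v\<close> in
    \<open>B i j\<close>, the block \<open>j\<close> contains \<open>p u\<close> and lies in the
    rank range of \<open>v\<close>; so the x-condition is automatic and only y remains.\<close>
  define A where "A = (\<lambda>i j. {u\<in>S. p u div 2 ^ i = j})"
  define B where "B = (\<lambda>i j. {v\<in>S. canonical (p v) (r v) i j})"
  have AB: "finite (A i j)" "finite (B i j)" "\<And>u. u \<in> A i j \<union> B i j \<Longrightarrow> yl u \<le> yr u" for i j
    using S le by (auto simp: A_def B_def)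
  define good where "good = (\<lambda>i j P.
      P \<subseteq> {(u, v). u \<in> A i j \<and> v \<in> B i j \<and> yl v \<le> yr u \<and> yl u \<le> yr v} \<and>
      card P \<le> 3 * (card (A i j) + card (B i j)) \<and>
      (\<forall>u\<in>A i j. \<forall>v\<in>B i j. yl v \<le> yr u \<and> yl u \<le> yr v \<longrightarrow> linked P u v))"
  have "\<exists>P. good i j P" for i j
    unfolding good_def by (rule overlap_spanner[OF AB(1,2)]) (erule AB(3))
  then obtain Q where good: "\<And>i j. good i j (Q i j)" by metis
  have Q: "Q i j \<subseteq> {(u, v). u \<in> A i j \<and> v \<in> B i j \<and> yl v \<le> yr u \<and> yl u \<le> yr v}"
    "card (Q i j) \<le> 3 * (card (A i j) + card (B i j))"
    "\<And>u v. u \<in> A i j \<Longrightarrow> v \<in> B i j \<Longrightarrow> yl v \<le> yr u \<Longrightarrow> yl u \<le> yr v \<Longrightarrow> linked (Q i j) u v"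
    for i j
    using good[of i j] unfolding good_def by blast+
  \<comment> \<open>The indices \<open>j\<close> up to \<open>n\<close> suffice, because
    \<open>p u div 2 ^ i\<close> is at most \<open>p u\<close> and hence at most
    \<open>n\<close>.\<close>
  define P where "P = (\<Union>i<k. \<Union>j\<le>n. Q i j)"
  have level: "card (\<Union>j\<le>n. Q i j) \<le> 9 * n" for i
  proof -
    have "(\<Sum>j\<le>n. card (A i j)) = (\<Sum>u\<in>S. card {j\<in>{..n}. p u div 2 ^ i = j})"
      unfolding A_def by (rule sum_card_swap) (use S in auto)
    also have "\<dots> \<le> (\<Sum>u\<in>S. card {p u div 2 ^ i})"
      by (intro sum_mono card_mono) auto
    finally have a: "(\<Sum>j\<le>n. card (A i j)) \<le> n" by (simp add: n_def)
    have "(\<Sum>j\<le>n. card (B i j)) = (\<Sum>v\<in>S. card {j\<in>{..n}. canonical (p v) (r v) i j})"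
      unfolding B_def by (rule sum_card_swap) (use S in auto)
    also have "\<dots> \<le> (\<Sum>v\<in>S. 2)"
      by (intro sum_mono order_trans[OF card_mono canonical_card] canonical_finite) auto
    finally have b: "(\<Sum>j\<le>n. card (B i j)) \<le> 2 * n" by (simp add: n_def)
    have "card (\<Union>j\<le>n. Q i j) \<le> (\<Sum>j\<le>n. card (Q i j))"
      by (rule card_UN_le) simp
    also have "\<dots> \<le> (\<Sum>j\<le>n. 3 * (card (A i j) + card (B i j)))"
      by (intro sum_mono Q(2))
    also have "\<dots> = 3 * ((\<Sum>j\<le>n. card (A i j)) + (\<Sum>j\<le>n. card (B i j)))"
      by (simp add: sum_distrib_left sum.distrib)
    also have "\<dots> \<le> 3 * (n + 2 * n)"
      by (intro mult_le_mono2 add_mono a b)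
    finally show ?thesis by simp
  qed
  have "card P \<le> (\<Sum>i<k. card (\<Union>j\<le>n. Q i j))"
    unfolding P_def by (rule card_UN_le) simp
  also have "\<dots> \<le> (\<Sum>i<k. 9 * n)" by (intro sum_mono level)
  finally have "card P \<le> 9 * card S * k" by (simp add: n_def mult.commute)
  moreover have "P \<subseteq> {(u, v). u \<in> S \<and> v \<in> S \<and> xl v \<le> xl u \<and> xl u \<le> xr v \<and> yl v \<le> yr u \<and> yl u \<le> yr v}"
  proof -
    have "u \<in> S \<and> v \<in> S \<and> xl v \<le> xl u \<and> xl u \<le> xr v \<and> yl v \<le> yr u \<and> yl u \<le> yr v"
      if "(u, v) \<in> Q i j" for u v i j
    proof -
      have uv: "u \<in> S" "v \<in> S" "canonical (p v) (r v) i (p u div 2 ^ i)" "yl v \<le> yr u" "yl u \<le> yr v"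
        using that Q(1)[of i j] by (auto simp: A_def B_def)
      then show ?thesis
        using canonical_contains[OF uv(3)] p_le[of u v] p_less[of u v] by blast
    qed
    then show ?thesis by (auto simp: P_def)
  qed
  moreover have "linked P u v"
    if uv: "u \<in> S" "v \<in> S" "xl v \<le> xl u" "xl u \<le> xr v" "yl v \<le> yr u" "yl u \<le> yr v" for u v
  proof -
    have "p v \<le> p u" "p u < r v" "r v < 2 ^ k"
      using uv p_le p_less r_le[of v] k by (auto simp: n_def)
    then obtain i where i: "i < k" "canonical (p v) (r v) i (p u div 2 ^ i)"
      using canonical_cover by blast
    define j where "j = p u div 2 ^ i"
    have "j \<le> p u" by (simp add: j_def)
    then have "j \<le> n" using p_bound[of u] by simp
    moreover have "u \<in> A i j" "v \<in> B i j"
      using i uv by (auto simp: A_def B_def j_def)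
    ultimately have "linked (Q i j) u v" "Q i j \<subseteq> P"
      using Q(3) uv i(1) by (auto simp: P_def)
    then show ?thesis by (rule linked_mono)
  qed
  ultimately show ?thesis by (intro exI[of _ P]) blast
qed

section \<open>Hop paths from linked pairs\<close>

lemma hop_path_mono:
  assumes "hop_path H s u v" "s \<le> t"
  shows "hop_path H t u v"
proof -
  from assms(1) obtain ps where "ps \<noteq> []" "hd ps = u" "last ps = v" "length ps \<le> s + 1"
    "\<forall>i < length ps - 1. {ps ! i, ps ! (i + 1)} \<in> H"
    unfolding hop_path_def by blast
  with assms(2) show ?thesis
    unfolding hop_path_def by (intro exI[of _ ps]) simp
qed

lemma hop_path_refl: "hop_path H 0 u u"
  unfolding hop_path_def by (intro exI[of _ "[u]"]) simp

text \<open>Standing still counts as a step, because a pair (u, u) of the relation yields no edge of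
  the graph.\<close>

lemma hop_path_step:
  assumes "hop_path H t u v" "v = w \<or> {v, w} \<in> H"
  shows "hop_path H (Suc t) u w"
proof (cases "v = w")
  case True
  then show ?thesis using assms(1) hop_path_mono[of H t u v "Suc t"] by simp
next
  case False
  obtain ps where ps: "ps \<noteq> []" "hd ps = u" "last ps = v" "length ps \<le> t + 1"
    "\<And>i. i < length ps - 1 \<Longrightarrow> {ps ! i, ps ! (i + 1)} \<in> H"
    using assms(1) unfolding hop_path_def by blast
  have "{(ps @ [w]) ! i, (ps @ [w]) ! (i + 1)} \<in> H" if "i < length ps" for i
  proof (cases "i < length ps - 1")
    case True
    then have "i + 1 < length ps" by simp
    with True show ?thesis using ps(5)[of i] by (simp add: nth_append)
  next
    case False
    then have "i = length ps - 1" using that by simp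
    then show ?thesis
      using ps(1,3) \<open>v \<noteq> w\<close> assms(2) by (simp add: nth_append last_conv_nth)
  qed
  then show ?thesis
    unfolding hop_path_def using ps by (intro exI[of _ "ps @ [w]"]) auto
qed

lemma hop_path_3:
  assumes "u = a \<or> {u, a} \<in> H" "a = b \<or> {a, b} \<in> H" "b = v \<or> {b, v} \<in> H"
  shows "hop_path H 3 u v"
  unfolding numeral_3_eq_3
  by (rule hop_path_step[OF hop_path_step[OF hop_path_step[OF hop_path_refl assms(1)] assms(2)] assms(3)])

section \<open>The logarithmic bound and the assembly for rectangles\<close>

text \<open>Take k = m + 1, where \<open>2 ^ m\<close> is the largest power of two not above
  \<open>n\<close>. From \<open>ln 2\<close> being at least 1/2 follows that m is at most 2 ln n,
  and m + 1 is at most 2m because m is at least 1; hence the factor 4.\<close>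

lemma ex_power_two_le_ln:
  assumes "2 \<le> n"
  shows "\<exists>k. n < 2 ^ k \<and> real k \<le> 4 * ln (real n)"
proof -
  obtain m where m: "2 ^ m \<le> n" "n < 2 ^ (m + 1)"
    using ex_power_ivl1[of 2 n] assms by auto
  have "m \<ge> 1" using m(2) assms by (cases m) auto
  have "real m * ln 2 = ln (2 ^ m)" by (simp add: ln_realpow)
  also have "\<dots> \<le> ln (real n)"
    using m(1) assms by (subst ln_le_cancel_iff) (auto simp flip: of_nat_power simp: numeral_power_le_of_nat_cancel_iff)
  finally have "real m * ln 2 \<le> ln (real n)" .
  moreover have "1 / 2 \<le> ln (2::real)"
    using ln_le_minus_one[of "1 / 2 :: real"] by (simp add: ln_div)
  then have "real m * (1 / 2) \<le> real m * ln 2"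
    by (intro mult_left_mono) auto
  ultimately have "real (m + 1) \<le> 4 * ln (real n)"
    using \<open>m \<ge> 1\<close> unfolding of_nat_add by linarith
  with m(2) show ?thesis by blast
qed

theorem theorem20:
  shows "\<exists>C::real. C > 0 \<and>
    (\<forall>S :: (real \<times> real) set set. finite S \<and> (\<forall>R \<in> S. axis_rect R) \<longrightarrow>
       (\<exists>H. is_hop_spanner (isect_edges S) H 3 \<and>
            real (card H) \<le> C * real (card S) * ln (real (card S))))"
proof (intro exI[of _ 36] conjI allI impI)
  fix S :: "(real \<times> real) set set"
  assume "finite S \<and> (\<forall>R \<in> S. axis_rect R)"
  then have S: "finite S" and rect: "\<And>R. R \<in> S \<Longrightarrow> axis_rect R" by auto
  show "\<exists>H. is_hop_spanner (isect_edges S) H 3 \<and>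
            real (card H) \<le> 36 * real (card S) * ln (real (card S))"
  proof (cases "card S \<ge> 2")
    \<comment> \<open>The bound is 0 here, through the factor \<open>card S\<close> or through ln 1
      = 0; the empty spanner meets it, as there are no edges.\<close>
    case False
    then have "u = v" if "u \<in> S" "v \<in> S" for u v
      using that S card_le_Suc0_iff_eq[OF S] by auto
    then have "isect_edges S = {}" unfolding isect_edges_def by blast
    then have "is_hop_spanner (isect_edges S) {} 3" by (simp add: is_hop_spanner_def)
    moreover have "card S = 0 \<or> card S = 1" using False by auto
    ultimately show ?thesis by (intro exI[of _ "{}"]) auto
  next
    case True
    obtain k where k: "card S < 2 ^ k" "real k \<le> 4 * ln (real (card S))"
      using ex_power_two_le_ln[OF True] by blast
    obtain xl xr yl yr where box: "\<And>R. R \<in> S \<Longrightarrow> xl R \<le> xr R" "\<And>R. R \<in> S \<Longrightarrow> yl R \<le> yr R"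
      "\<And>R. R \<in> S \<Longrightarrow> R = {xl R..xr R} \<times> {yl R..yr R}"
      using rect unfolding axis_rect_def by metis
    have meet: "u \<inter> v \<noteq> {} \<longleftrightarrow> xl v \<le> xr u \<and> xl u \<le> xr v \<and> yl v \<le> yr u \<and> yl u \<le> yr v"
      if "u \<in> S" "v \<in> S" for u v
    proof -
      have "u \<inter> v = {max (xl u) (xl v)..min (xr u) (xr v)} \<times> {max (yl u) (yl v)..min (yr u) (yr v)}"
        using arg_cong2[OF box(3)[OF that(1)] box(3)[OF that(2)], of "(\<inter>)"]
        by (simp add: Times_Int_Times inf_min sup_max)
      then show ?thesis
        using box(1,2)[OF that(1)] box(1,2)[OF that(2)] by auto
    qed
    obtain P where sub: "P \<subseteq> {(u, v). u \<in> S \<and> v \<in> S \<and> xl v \<le> xl u \<and> xl u \<le> xr v \<and>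
          yl v \<le> yr u \<and> yl u \<le> yr v}"
      and cardP: "card P \<le> 9 * card S * k"
      and link: "\<forall>u\<in>S. \<forall>v\<in>S. xl v \<le> xl u \<and> xl u \<le> xr v \<and> yl v \<le> yr u \<and> yl u \<le> yr v \<longrightarrow>
          linked P u v"
    proof (rule exE[OF box_spanner[OF S k(1), where xl = xl and xr = xr and yl = yl and yr = yr]])
      show "yl u \<le> yr u" if "u \<in> S" for u using box(2)[OF that] .
    qed (elim conjE, rule that, assumption+)
    have P: "u \<in> S \<and> v \<in> S \<and> xl v \<le> xl u \<and> xl u \<le> xr v \<and> yl v \<le> yr u \<and> yl u \<le> yr v"
      if "(u, v) \<in> P" for u v
      using subsetD[OF sub that] by simp
    have "P \<subseteq> S \<times> S" using P by auto
    then have "finite P" using S by (meson finite_SigmaI finite_subset)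
    \<comment> \<open>Orientation is forgotten and the pairs (u, u) are removed: \<open>P\<close>
      may contain them, since a box overlaps itself.\<close>
    define H where "H = (\<lambda>(u, v). {u, v}) ` {(u, v) \<in> P. u \<noteq> v}"
    have H: "u = v \<or> {u, v} \<in> H" "v = u \<or> {v, u} \<in> H" if "(u, v) \<in> P" for u v
      using that unfolding H_def by (auto simp: insert_commute image_iff intro!: bexI[of _ "(u, v)"])
    have "card H \<le> card {(u, v) \<in> P. u \<noteq> v}"
      unfolding H_def by (rule card_image_le) (rule finite_subset[OF _ \<open>finite P\<close>], auto)
    also have "\<dots> \<le> card P" by (rule card_mono[OF \<open>finite P\<close>]) auto
    finally have "card H \<le> 9 * card S * k" using cardP by simp
    then have "real (card H) \<le> 9 * real (card S) * real k"
      by (metis of_nat_le_iff of_nat_mult of_nat_numeral)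
    \<comment> \<open>The 9 of \<open>box_spanner\<close> times the 4 of the logarithmic bound gives
      the constant 36.\<close>
    also have "\<dots> \<le> 9 * real (card S) * (4 * ln (real (card S)))"
      by (intro mult_left_mono k(2)) simp
    finally have "real (card H) \<le> 36 * real (card S) * ln (real (card S))" by simp
    moreover have "H \<subseteq> isect_edges S"
    proof
      fix e assume "e \<in> H"
      then obtain u v where uv: "e = {u, v}" "(u, v) \<in> P" "u \<noteq> v" by (auto simp: H_def)
      then have "u \<inter> v \<noteq> {}"
        using P[OF uv(2)] meet[of u v] box(1)[of u] by linarith
      then show "e \<in> isect_edges S"
        using uv P[OF uv(2)] unfolding isect_edges_def by blast
    qed
    moreover have "hop_path H 3 u v" if "{u, v} \<in> isect_edges S" for u v
    proof -
      have uv: "u \<in> S" "v \<in> S" "u \<inter> v \<noteq> {}"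
        using that unfolding isect_edges_def by (auto simp: doubleton_eq_iff)
      then have o: "xl v \<le> xr u" "xl u \<le> xr v" "yl v \<le> yr u" "yl u \<le> yr v"
        using meet by auto
      show ?thesis
      \<comment> \<open>\<open>P\<close> serves pairs whose second left end is not to the right of
        the first. In the other case it links \<open>v\<close> to \<open>u\<close>, and the path is
        read backwards.\<close>
      proof (cases "xl v \<le> xl u")
        case True
        then obtain u' v' where "(u, v') \<in> P" "(u', v') \<in> P" "(u', v) \<in> P"
          using link uv o unfolding linked_def by blast
        then show ?thesis by (intro hop_path_3[of u v' H u' v] H)
      next
        case False
        then obtain u' v' where "(v, v') \<in> P" "(u', v') \<in> P" "(u', u) \<in> P"
          using bspec[OF bspec[OF link uv(2)] uv(1)] o by (auto simp: linked_def)
        then show ?thesis by (intro hop_path_3[of u u' H v' v] H)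
      qed
    qed
    ultimately show ?thesis by (auto simp: is_hop_spanner_def)
  qed
qed simp

end
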